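(* Let $N=\{1,\dots,n\}$, let $(\bm{x}_i,y_i)\in\mathbb{R}^d\times\{-1,1\}$ for $i\in N$, let $C>0$, and let $\lambda_k\ge0$ for $k\in N$ (not necessarily monotone). Given an optimal solution $(\bm{w}^*,b^*,\bm{\xi}^*,\bm{\theta}^*,\bm{z}^* )$ of (NC-OWA-SVM), there can be built a feasible solution $(\bm{\alpha}^*,b^*,\bm{\xi}^*,\bm{\theta}^*,\bm{z}^* )$ of (NC-OWA-SVM$_D$) (with the same $b^*,\bm{\xi}^*,\bm{\theta}^*,\bm{z}^*$) having the same objective value.
   Context: $M$ is a fixed (sufficiently large) big-$M$ constant, the same in both problems; the maximum distance between two points of the training data is taken as a valid value of $M$. The problem (NC-OWA-SVM) is $$\min_{\bm{w},b,\bm{\xi},\bm{z},\bm{\theta}}\ \frac12\|\bm{w}\|_2^2+C\sum_{k=1}^n\lambda_k\theta_k$$ subject to $$y_i(\bm{w}^T\bm{x}_i+b)\ge1-\xi_i,\quad i\in N,$$ $$\sum_{i=1}^nz_{ij}=1,\quad j\in N,$$ $$\theta_k\ge\xi_i-M\Bigl(1-\sum_{j=1}^{k}z_{ij}\Bigr),\quad i,k\in N,$$ $$z_{ik}\in\{0,1\}\ (i,k\in N),\quad \theta_k\ge0\ (k\in N),\quad \bm{w}\in\mathbb{R}^d,\quad b\in\mathbb{R},\quad \xi_i\ge0\ (i\in N).$$ The problem (NC-OWA-SVM$_D$), with variables $\bm{\alpha}\in\mathbb{R}^n$, $b,\bm{\xi},\bm{\theta},\bm{z}$, is $$\min_{\bm{\alpha},b,\bm{\xi},\bm{\theta},\bm{z}}\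 \frac12\sum_{i=1}^n\sum_{j=1}^ny_iy_j\alpha_i\alpha_j\,\bm{x}_i\cdot\bm{x}_j+C\sum_{k=1}^n\lambda_k\theta_k$$ subject to $$y_i\Bigl(\sum_{j=1}^ny_j\alpha_j\,\bm{x}_i\cdot\bm{x}_j+b\Bigr)\ge1-\xi_i,\quad i\in N,$$ $$\sum_{i=1}^nz_{ij}=1,\quad j\in N,$$ $$\theta_k\ge\xi_i-M\Bigl(1-\sum_{j=1}^{k}z_{ij}\Bigr),\quad i,k\in N,$$ $$z_{ik}\in\{0,1\}\ (i,k\in N),\quad \theta_k\ge0\ (k\in N),\quad b\in\mathbb{R},\quad \xi_i\ge0\ (i\in N).$$ *)

theory Defs
  imports "HOL-Analysis.Analysis"
begin

text \<open>
  Training data are functions on \<^typ>\<open>nat\<close> of which only the values on the index set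
  \<open>N = {1..n}\<close> are used; likewise the decision vectors \<open>\<alpha>\<close>, \<open>\<xi>\<close>, \<open>\<theta>\<close> and the decision
  matrix \<open>z\<close> are unconstrained, and irrelevant to the objectives, outside \<open>N\<close>.
  Solutions are tuples \<open>(w, b, \<xi>, \<theta>, z)\<close> and \<open>(\<alpha>, b, \<xi>, \<theta>, z)\<close> respectively.
  The big-M constant \<open>M\<close> is an explicit parameter, with no fixed size, of both feasible sets;
  \<open>l k\<close> stands for \<open>\<lambda>\<^sub>k\<close>.
\<close>

definition nc_owa_svm_feasible ::
  "nat \<Rightarrow> (nat \<Rightarrow> real ^ 'd) \<Rightarrow> (nat \<Rightarrow> real) \<Rightarrow> real \<Rightarrow>
   (real ^ 'd) \<times> real \<times> (nat \<Rightarrow> real) \<times> (nat \<Rightarrow> real) \<times> (nat \<Rightarrow> nat \<Rightarrow> real) \<Rightarrow> bool"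
  where
  "nc_owa_svm_feasible n x y M = (\<lambda>(w, b, \<xi>, \<theta>, z).
     (\<forall>i\<in>{1..n}. y i * (w \<bullet> x i + b) \<ge> 1 - \<xi> i) \<and>
     (\<forall>j\<in>{1..n}. (\<Sum>i=1..n. z i j) = 1) \<and>
     (\<forall>i\<in>{1..n}. \<forall>k\<in>{1..n}. \<theta> k \<ge> \<xi> i - M * (1 - (\<Sum>j=1..k. z i j))) \<and>
     (\<forall>i\<in>{1..n}. \<forall>k\<in>{1..n}. z i k \<in> {0, 1}) \<and>
     (\<forall>k\<in>{1..n}. \<theta> k \<ge> 0) \<and>
     (\<forall>i\<in>{1..n}. \<xi> i \<ge> 0))"

definition nc_owa_svm_objective ::
  "nat \<Rightarrow> real \<Rightarrow> (nat \<Rightarrow> real) \<Rightarrow>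
   (real ^ 'd) \<times> real \<times> (nat \<Rightarrow> real) \<times> (nat \<Rightarrow> real) \<times> (nat \<Rightarrow> nat \<Rightarrow> real) \<Rightarrow> real"
  where
  "nc_owa_svm_objective n C l = (\<lambda>(w, b, \<xi>, \<theta>, z).
     1 / 2 * (norm w)\<^sup>2 + C * (\<Sum>k=1..n. l k * \<theta> k))"

definition nc_owa_svm_optimal ::
  "nat \<Rightarrow> (nat \<Rightarrow> real ^ 'd) \<Rightarrow> (nat \<Rightarrow> real) \<Rightarrow> real \<Rightarrow> real \<Rightarrow> (nat \<Rightarrow> real) \<Rightarrow>
   (real ^ 'd) \<times> real \<times> (nat \<Rightarrow> real) \<times> (nat \<Rightarrow> real) \<times> (nat \<Rightarrow> nat \<Rightarrow> real) \<Rightarrow> bool"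
  where
  "nc_owa_svm_optimal n x y M C l =
     is_arg_min (nc_owa_svm_objective n C l) (nc_owa_svm_feasible n x y M)"

definition nc_owa_svm_d_feasible ::
  "nat \<Rightarrow> (nat \<Rightarrow> real ^ 'd) \<Rightarrow> (nat \<Rightarrow> real) \<Rightarrow> real \<Rightarrow>
   (nat \<Rightarrow> real) \<times> real \<times> (nat \<Rightarrow> real) \<times> (nat \<Rightarrow> real) \<times> (nat \<Rightarrow> nat \<Rightarrow> real) \<Rightarrow> bool"
  where
  "nc_owa_svm_d_feasible n x y M = (\<lambda>(\<alpha>, b, \<xi>, \<theta>, z).
     (\<forall>i\<in>{1..n}. y i * ((\<Sum>j=1..n. y j * \<alpha> j * (x i \<bullet> x j)) + b) \<ge> 1 - \<xi> i) \<and>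
     (\<forall>j\<in>{1..n}. (\<Sum>i=1..n. z i j) = 1) \<and>
     (\<forall>i\<in>{1..n}. \<forall>k\<in>{1..n}. \<theta> k \<ge> \<xi> i - M * (1 - (\<Sum>j=1..k. z i j))) \<and>
     (\<forall>i\<in>{1..n}. \<forall>k\<in>{1..n}. z i k \<in> {0, 1}) \<and>
     (\<forall>k\<in>{1..n}. \<theta> k \<ge> 0) \<and>
     (\<forall>i\<in>{1..n}. \<xi> i \<ge> 0))"

definition nc_owa_svm_d_objective ::
  "nat \<Rightarrow> (nat \<Rightarrow> real ^ 'd) \<Rightarrow> (nat \<Rightarrow> real) \<Rightarrow> real \<Rightarrow> (nat \<Rightarrow> real) \<Rightarrow>
   (nat \<Rightarrow> real) \<times> real \<times> (nat \<Rightarrow> real) \<times> (nat \<Rightarrow> real) \<times> (nat \<Rightarrow> nat \<Rightarrow> real) \<Rightarrow> real"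
  where
  "nc_owa_svm_d_objective n x y C l = (\<lambda>(\<alpha>, b, \<xi>, \<theta>, z).
     1 / 2 * (\<Sum>i=1..n. \<Sum>j=1..n. y i * y j * \<alpha> i * \<alpha> j * (x i \<bullet> x j)) +
     C * (\<Sum>k=1..n. l k * \<theta> k))"

end

theory Submission
  imports Defs
begin

text \<open>
  This is the representer theorem. The constraints see the normal vector only through its
  inner products with the data points, so replacing \<open>w\<close> by its orthogonal projection \<open>p\<close> onto
  the span of the data keeps \<open>(w, b, \<xi>, \<theta>, z)\<close> feasible and leaves the loss term
  unchanged, while the norm strictly decreases unless \<open>w = p\<close>. An optimal \<open>w\<close> is therefore a
  linear combination \<open>\<Sum>j. c j *\<^sub>R x j\<close> of the data (\<open>optimal_normal_in_span\<close>).

  As \<open>y j\<close> is a sign, \<open>\<alpha> j = y j * c j\<close> satisfies \<open>y j * \<alpha> j = c j\<close>. With this choice, the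
  kernel sums in the second problem are the inner products \<open>w \<bullet> x i\<close>, and its quadratic
  form is the squared norm of \<open>w\<close>, so the constraints and the objectives coincide.
\<close>

text \<open>
  Coefficients are attached to indices rather than to points, because data points may repeat
  while each index carries its own multiplier.
\<close>
lemma span_image_imp_indexed_sum:
  fixes x :: "'i \<Rightarrow> 'a::real_vector"
  assumes "finite I" and "v \<in> span (x ` I)"
  shows "\<exists>c. v = (\<Sum>j\<in>I. c j *\<^sub>R x j)"
  using assms(2)
proof (induction rule: span_induct_alt)
  case base
  have "0 = (\<Sum>j\<in>I. 0 *\<^sub>R x j)" by simp
  then show ?case by (rule exI[where x = "\<lambda>_. 0"])
next
  case (step a u v)
  then obtain i c where i: "i \<in> I" "u = x i" and c: "v = (\<Sum>j\<in>I. c j *\<^sub>R x j)"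
    by blast
  have "(\<Sum>j\<in>I. (if j = i then a else 0) *\<^sub>R x j) = a *\<^sub>R x i"
    using assms(1) i(1) by (simp add: if_distrib[of "\<lambda>r. r *\<^sub>R _"] cong: if_cong)
  then have "a *\<^sub>R u + v = (\<Sum>j\<in>I. (c j + (if j = i then a else 0)) *\<^sub>R x j)"
    by (simp add: i(2) c scaleR_add_left sum.distrib)
  then show ?case by (rule exI[where x = "\<lambda>j. c j + (if j = i then a else 0)"])
qed

lemma norm_power2_indexed_sum:
  fixes x :: "'i \<Rightarrow> 'a::real_inner"
  shows "(norm (\<Sum>j\<in>I. c j *\<^sub>R x j))\<^sup>2 = (\<Sum>i\<in>I. \<Sum>j\<in>I. c i * c j * (x i \<bullet> x j))"
  unfolding power2_norm_eq_inner inner_sum_left inner_sum_right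
  by (simp add: inner_commute mult_ac)

text \<open>
  The component of the normal vector orthogonal to the data has no effect on the margins but
  contributes its squared norm to the objective, so an optimal normal vector has none.
\<close>
lemma optimal_normal_in_span:
  assumes "nc_owa_svm_optimal n x y M C l (w, b, \<xi>, \<theta>, z)"
  shows "w \<in> span (x ` {1..n})"
proof -
  obtain p q where p: "p \<in> span (x ` {1..n})"
    and orth: "\<And>u. u \<in> span (x ` {1..n}) \<Longrightarrow> orthogonal q u" and w: "w = p + q"
    using orthogonal_subspace_decomp_exists[of "x ` {1..n}" w] by metis
  have margins: "w \<bullet> x i = p \<bullet> x i" if "i \<in> {1..n}" for i
  proof -
    have "q \<bullet> x i = 0"
      using orth[OF span_base[OF imageI[OF that, of x]]] by (simp add: orthogonal_def)
    then show ?thesis by (simp add: w inner_add_left)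
  qed
  have "nc_owa_svm_feasible n x y M (w, b, \<xi>, \<theta>, z)"
    using assms by (simp add: nc_owa_svm_optimal_def is_arg_min_def)
  then have "nc_owa_svm_feasible n x y M (p, b, \<xi>, \<theta>, z)"
    using margins by (simp add: nc_owa_svm_feasible_def)
  then have "\<not> nc_owa_svm_objective n C l (p, b, \<xi>, \<theta>, z)
               < nc_owa_svm_objective n C l (w, b, \<xi>, \<theta>, z)"
    using assms by (auto simp: nc_owa_svm_optimal_def is_arg_min_def)
  then have "(norm w)\<^sup>2 \<le> (norm p)\<^sup>2"
    by (simp add: nc_owa_svm_objective_def not_less del: power_mono_iff)
  moreover have "(norm w)\<^sup>2 = (norm p)\<^sup>2 + (norm q)\<^sup>2"
    unfolding w using orth[OF p] by (intro norm_add_Pythagorean) (simp add: orthogonal_commute)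
  ultimately have "q = 0" by simp
  with p w show ?thesis by simp
qed

theorem proposition4p1:
  fixes n :: nat
    and x :: "nat \<Rightarrow> real ^ 'd"
    and y :: "nat \<Rightarrow> real"
    and M C :: real
    and l :: "nat \<Rightarrow> real"
    and w :: "real ^ 'd"
    and b :: real
    and \<xi> \<theta> :: "nat \<Rightarrow> real"
    and z :: "nat \<Rightarrow> nat \<Rightarrow> real"
  assumes "\<And>i. i \<in> {1..n} \<Longrightarrow> y i \<in> {-1, 1}"
    and "C > 0"
    and "\<And>k. k \<in> {1..n} \<Longrightarrow> l k \<ge> 0"
    and "nc_owa_svm_optimal n x y M C l (w, b, \<xi>, \<theta>, z)"
  shows "\<exists>\<alpha> :: nat \<Rightarrow> real.
           nc_owa_svm_d_feasible n x y M (\<alpha>, b, \<xi>, \<theta>, z) \<and>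
           nc_owa_svm_d_objective n x y C l (\<alpha>, b, \<xi>, \<theta>, z) =
             nc_owa_svm_objective n C l (w, b, \<xi>, \<theta>, z)"
proof -
  obtain c where w: "w = (\<Sum>j=1..n. c j *\<^sub>R x j)"
    using span_image_imp_indexed_sum[OF _ optimal_normal_in_span[OF assms(4)]] by auto
  define \<alpha> where "\<alpha> = (\<lambda>j. y j * c j)"
  have coeff: "y j * \<alpha> j = c j" if "j \<in> {1..n}" for j
    using assms(1)[OF that] by (auto simp: \<alpha>_def)
  have margin: "(\<Sum>j=1..n. y j * \<alpha> j * (x i \<bullet> x j)) = w \<bullet> x i" for i
    by (simp add: w coeff inner_sum_left inner_commute[of "x i"])
  have "y i * y j * \<alpha> i * \<alpha> j * (x i \<bullet> x j) = c i * c j * (x i \<bullet> x j)"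
    if "i \<in> {1..n}" "j \<in> {1..n}" for i j
    by (simp flip: coeff[OF that(1)] coeff[OF that(2)])
  then have quadratic_form:
    "(\<Sum>i=1..n. \<Sum>j=1..n. y i * y j * \<alpha> i * \<alpha> j * (x i \<bullet> x j)) = (norm w)\<^sup>2"
    unfolding w norm_power2_indexed_sum by (intro sum.cong refl) blast
  have "nc_owa_svm_feasible n x y M (w, b, \<xi>, \<theta>, z)"
    using assms(4) by (simp add: nc_owa_svm_optimal_def is_arg_min_def)
  then have "nc_owa_svm_d_feasible n x y M (\<alpha>, b, \<xi>, \<theta>, z)"
    by (simp add: nc_owa_svm_d_feasible_def nc_owa_svm_feasible_def margin del: One_nat_def)
  moreover have "nc_owa_svm_d_objective n x y C l (\<alpha>, b, \<xi>, \<theta>, z) =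
                   nc_owa_svm_objective n C l (w, b, \<xi>, \<theta>, z)"
    by (simp add: nc_owa_svm_d_objective_def nc_owa_svm_objective_def quadratic_form
        del: One_nat_def)
  ultimately show ?thesis by blast
qed

end
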